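(* Let $G$ be a finite connected graph and let $J$ be a finite disconnected graph with $n \geq 2$ components. Then $c_H(G \vee J) \leq c_H(G) + 2$.
   Context: The join $G \vee J$ has vertex set $V(G) \cup V(J)$ (disjoint union) and edge set $E(G) \cup E(J) \cup \{uv : u \in V(G), v \in V(J)\}$. Hyperopic Cops and Robber on a graph $H$ (each vertex considered to carry a loop, so a player may stay put): the cops first occupy a multiset of vertices, then the robber chooses a vertex. In each round, each cop moves to an adjacent vertex or stays, then the robber moves to an adjacent vertex or stays. The robber always sees all cops. The cops see the robber's position except when the robber's vertex is adjacent to every vertex occupied by a cop, in which case the robber is invisible. The robber is captured when a cop occupies the robber's vertex. $c_H(H)$ is the minimum number of cops that can guarantee capture in finitely many moves. *)

theory Defs
  imports "Graph_Theory.Digraph_Component"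
begin

text \<open>
  Finite simple graphs are the structures satisfying \<^locale>\<open>pair_graph\<close>: finite, symmetric and
  loop-free. The loop that every vertex carries in the game is added by \<open>adj\<close>.
\<close>

definition graph_join ::
  "'a pair_pre_digraph \<Rightarrow> 'b pair_pre_digraph \<Rightarrow> ('a + 'b) pair_pre_digraph" where
  "graph_join G J =
    \<lparr> pverts = pverts G <+> pverts J,
      parcs = {(Inl u, Inl v) | u v. (u, v) \<in> parcs G}
            \<union> {(Inr u, Inr v) | u v. (u, v) \<in> parcs J}
            \<union> {(Inl u, Inr v) | u v. u \<in> pverts G \<and> v \<in> pverts J}
            \<union> {(Inr v, Inl u) | u v. u \<in> pverts G \<and> v \<in> pverts J} \<rparr>"

definition adj :: "'a pair_pre_digraph \<Rightarrow> 'a \<Rightarrow> 'a \<Rightarrow> bool" where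
  "adj G u v \<longleftrightarrow> u \<in> pverts G \<and> v \<in> pverts G \<and> (u = v \<or> (u, v) \<in> parcs G)"

text \<open>
  A position of \<open>k\<close> cops is a list of length \<open>k\<close>, repetitions allowed: the cops are labelled, which
  lets a move be described cop by cop.

  What the cops see is \<open>None\<close> if the robber is invisible, and \<open>Some r\<close> otherwise. Using the looped
  adjacency here matters only if a cop already stands on the vertex of the robber, that is, once
  the game is over.
\<close>

definition observation :: "'a pair_pre_digraph \<Rightarrow> 'a list \<Rightarrow> 'a \<Rightarrow> 'a option" where
  "observation G C r = (if \<forall>c \<in> set C. adj G c r then None else Some r)"

text \<open>
  A strategy of the cops maps the list of everything seen so far, oldest entry first, to their next
  position; on the empty list it gives the initial placement. The cops thus have perfect recall, and
  no information on the robber other than the observations. (Their own earlier positions are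
  determined by these.) The cops look after every move of either side.
\<close>

type_synonym 'a strategy = "'a option list \<Rightarrow> 'a list"

text \<open>
  The vertex of the robber is \<open>\<rho> 0\<close> after the initial placement and \<open>\<rho> t\<close> after round \<open>t\<close>.
  In round \<open>Suc t\<close> the cops move first, while the robber is still on \<open>\<rho> t\<close>.
  \<open>seen G \<sigma> \<rho> t\<close> lists the observations made up to the end of round \<open>t\<close>.
\<close>

primrec seen :: "'a pair_pre_digraph \<Rightarrow> 'a strategy \<Rightarrow> (nat \<Rightarrow> 'a) \<Rightarrow> nat \<Rightarrow> 'a option list" where
  "seen G \<sigma> \<rho> 0 = [observation G (\<sigma> []) (\<rho> 0)]"
| "seen G \<sigma> \<rho> (Suc t) = seen G \<sigma> \<rho> t @
     [observation G (\<sigma> (seen G \<sigma> \<rho> t)) (\<rho> t), observation G (\<sigma> (seen G \<sigma> \<rho> t)) (\<rho> (Suc t))]"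

primrec cops_at :: "'a pair_pre_digraph \<Rightarrow> 'a strategy \<Rightarrow> (nat \<Rightarrow> 'a) \<Rightarrow> nat \<Rightarrow> 'a list" where
  "cops_at G \<sigma> \<rho> 0 = \<sigma> []"
| "cops_at G \<sigma> \<rho> (Suc t) = \<sigma> (seen G \<sigma> \<rho> t)"

definition robber_play :: "'a pair_pre_digraph \<Rightarrow> (nat \<Rightarrow> 'a) \<Rightarrow> bool" where
  "robber_play G \<rho> \<longleftrightarrow> \<rho> 0 \<in> pverts G \<and> (\<forall>t. adj G (\<rho> t) (\<rho> (Suc t)))"

definition legal_cop_play ::
  "'a pair_pre_digraph \<Rightarrow> nat \<Rightarrow> 'a strategy \<Rightarrow> (nat \<Rightarrow> 'a) \<Rightarrow> bool" where
  "legal_cop_play G k \<sigma> \<rho> \<longleftrightarrow>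
    length (cops_at G \<sigma> \<rho> 0) = k \<and> set (cops_at G \<sigma> \<rho> 0) \<subseteq> pverts G \<and>
    (\<forall>t. list_all2 (adj G) (cops_at G \<sigma> \<rho> t) (cops_at G \<sigma> \<rho> (Suc t)))"

text \<open>The two disjuncts are capture after a move of the robber and after a move of the cops.\<close>

definition captured :: "'a pair_pre_digraph \<Rightarrow> 'a strategy \<Rightarrow> (nat \<Rightarrow> 'a) \<Rightarrow> bool" where
  "captured G \<sigma> \<rho> \<longleftrightarrow>
    (\<exists>t. \<rho> t \<in> set (cops_at G \<sigma> \<rho> t) \<or> \<rho> t \<in> set (cops_at G \<sigma> \<rho> (Suc t)))"

text \<open>
  Quantifying over all plays \<open>\<rho>\<close> after the deterministic strategy \<open>\<sigma>\<close> accounts for a robber who sees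
  all cops and reacts to them. Both players formally go on for ever; this is harmless, since either
  may stay put once the robber is caught.
\<close>

definition cops_win :: "'a pair_pre_digraph \<Rightarrow> nat \<Rightarrow> bool" where
  "cops_win G k \<longleftrightarrow>
    (\<exists>\<sigma>. \<forall>\<rho>. robber_play G \<rho> \<longrightarrow> legal_cop_play G k \<sigma> \<rho> \<and> captured G \<sigma> \<rho>)"

definition hyperopic_cop_number :: "'a pair_pre_digraph \<Rightarrow> nat" (\<open>c\<^sub>H\<close>) where
  "c\<^sub>H G = (LEAST k. cops_win G k)"

text \<open>The minimum exists: enough cops can occupy all vertices at the start.\<close>

lemma (in pair_graph) cops_win_card_verts: "cops_win G (card (pverts G))"
proof -
  obtain C where C: "set C = pverts G" "distinct C"
    using finite_distinct_list[OF pair_finite_verts] by blast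
  let ?\<sigma> = "\<lambda>_. C"
  have at: "cops_at G ?\<sigma> \<rho> t = C" for \<rho> t
    by (cases t) simp_all
  have "list_all2 (adj G) C C"
    by (rule list.rel_refl_strong) (simp add: adj_def C(1))
  then have "legal_cop_play G (card (pverts G)) ?\<sigma> \<rho>" for \<rho>
    unfolding legal_cop_play_def at using C distinct_card[OF C(2)] by simp
  moreover have "captured G ?\<sigma> \<rho>" if "robber_play G \<rho>" for \<rho>
    using that C(1) unfolding captured_def at robber_play_def by blast
  ultimately show ?thesis
    unfolding cops_win_def by blast
qed

lemma pair_graph_graph_join:
  assumes "pair_graph G" and "pair_graph J"
  shows "pair_graph (graph_join G J)"
proof -
  interpret G: pair_graph G by fact
  interpret J: pair_graph J by fact
  have sub: "parcs (graph_join G J) \<subseteq> pverts (graph_join G J) \<times> pverts (graph_join G J)"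
    by (auto simp: graph_join_def dest: G.in_arcsD1 G.in_arcsD2 J.in_arcsD1 J.in_arcsD2)
  have fin: "finite (pverts (graph_join G J))"
    by (simp add: graph_join_def G.pair_finite_verts J.pair_finite_verts)
  show ?thesis
  proof
    show "finite (parcs (graph_join G J))"
      using sub fin by (meson finite_SigmaI finite_subset)
    show "symmetric (with_proj (graph_join G J))"
      by (auto simp: symmetric_def sym_def graph_join_def
          dest: G.arcs_symmetric J.arcs_symmetric)
    show "fst e \<noteq> snd e" if "e \<in> parcs (graph_join G J)" for e
      using that by (auto simp: graph_join_def dest: G.no_loops' J.no_loops')
  qed (use sub fin in auto)
qed

end

(*
  Two cops stand for ever on vertices a and b in different components of J, while the others
  follow a winning strategy on G. The two are adjacent to all of G, so they do not change what is seen
  of a robber in G; and since a and b have no common neighbour, a robber in J is always visible. As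
  soon as the robber enters J, some cop in G is adjacent to it and steps onto its vertex.
*)
theory Submission
  imports Defs
begin

section \<open>Adjacency and visibility in the join\<close>

lemma pverts_graph_join: "pverts (graph_join G J) = pverts G <+> pverts J"
  by (simp add: graph_join_def)

lemma adj_graph_join [simp]:
  "adj (graph_join G J) (Inl u) (Inl v) \<longleftrightarrow> adj G u v"
  "adj (graph_join G J) (Inr x) (Inr y) \<longleftrightarrow> adj J x y"
  "adj (graph_join G J) (Inl u) (Inr y) \<longleftrightarrow> u \<in> pverts G \<and> y \<in> pverts J"
  "adj (graph_join G J) (Inr x) (Inl v) \<longleftrightarrow> x \<in> pverts J \<and> v \<in> pverts G"
  by (auto simp: adj_def graph_join_def)

text \<open>Every vertex of \<open>D\<close> is adjacent to all of \<open>G\<close>, so the cops in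
  \<open>C\<close> alone decide whether a robber in \<open>G\<close> is invisible.\<close>

lemma observation_graph_join_Inl:
  assumes "r \<in> pverts G" and "set D \<subseteq> pverts J"
  shows "observation (graph_join G J) (map Inl C @ map Inr D) (Inl r) =
    map_option Inl (observation G C r)"
  using assms by (auto simp: observation_def ball_Un subset_iff)

lemma observation_graph_join_Inr:
  assumes "d \<in> set D" and "\<not> adj J d r"
  shows "observation (graph_join G J) (map Inl C @ map Inr D) (Inr r) = Some (Inr r)"
  using assms by (auto simp: observation_def ball_Un)

text \<open>Keeps the first sighting in \<open>J\<close> at a fixed place in all later
  histories.\<close>

lemma seen_prefix: "\<exists>ys. seen G \<sigma> \<rho> (t + m) = seen G \<sigma> \<rho> t @ ys"
  by (induction m) auto

section \<open>Connectedness, and games without cops\<close>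

text \<open>Used in contrapositive, to find the posts of the two stationary cops. Since
  \<open>adj\<close> has loops, \<open>r\<close> may coincide with \<open>a\<close> or
  \<open>b\<close> on the walk from \<open>a\<close> through \<open>r\<close> to
  \<open>b\<close>.\<close>

lemma connectedI_common_neighbour:
  assumes "pair_graph J" and "pverts J \<noteq> {}"
    and "\<And>a b. a \<in> pverts J \<Longrightarrow> b \<in> pverts J \<Longrightarrow> \<exists>r. adj J a r \<and> adj J b r"
  shows "Digraph_Component.connected (with_proj J)"
proof -
  interpret pair_graph J by fact
  have "a \<rightarrow>\<^sup>*\<^bsub>with_proj J\<^esub> b" if "a \<in> pverts J" "b \<in> pverts J" for a b
  proof -
    obtain r where r: "adj J a r" "adj J b r" using assms(3) \<open>a \<in> pverts J\<close> \<open>b \<in> pverts J\<close> by blast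
    have "c \<rightarrow>\<^sup>*\<^bsub>with_proj J\<^esub> d" if "adj J c d" for c d
      using that by (auto simp: adj_def)
    moreover have "adj J r b" using r(2) arcs_symmetric by (auto simp: adj_def)
    ultimately show ?thesis using r(1) reachable_trans by blast
  qed
  then show ?thesis
    using assms(2)
    by (auto simp: connected_def strongly_connected_def intro: reachable_mk_symmetricI)
qed

text \<open>Being strongly connected includes being nonempty. Hence the empty graph is not connected
  either, and it has to be ruled out for \<open>J\<close> by its components.\<close>

lemma verts_nonempty_if_sccs_nonempty:
  assumes "pre_digraph.sccs G \<noteq> {}"
  shows "verts G \<noteq> {}"
  using assms by (auto simp: pre_digraph.sccs_def strongly_connected_def induced_subgraph_def
      subgraph_def)

text \<open>Legal moves preserve the number of cops, so none ever appears and a robber who stays put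
  is never caught.\<close>

lemma not_cops_win_0:
  assumes "pverts G \<noteq> {}"
  shows "\<not> cops_win G 0"
proof
  assume "cops_win G 0"
  then obtain \<sigma> where \<sigma>: "robber_play G \<rho> \<Longrightarrow> legal_cop_play G 0 \<sigma> \<rho> \<and> captured G \<sigma> \<rho>" for \<rho>
    unfolding cops_win_def by blast
  obtain g where "g \<in> pverts G" using assms by blast
  then have "robber_play G (\<lambda>_. g)" by (simp add: robber_play_def adj_def)
  from \<sigma>[OF this] have legal: "legal_cop_play G 0 \<sigma> (\<lambda>_. g)" and cap: "captured G \<sigma> (\<lambda>_. g)"
    by auto
  have "cops_at G \<sigma> (\<lambda>_. g) t = []" for t
    using legal unfolding legal_cop_play_def
    by (induction t) (metis length_0_conv, metis list_all2_Nil)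
  then show False using cap by (simp only: captured_def) simp
qed

section \<open>The strategy on the join and its simulation of the game on \<open>G\<close>\<close>

fun seen_right :: "('a + 'b) option \<Rightarrow> bool" where
  "seen_right (Some (Inr _)) = True"
| "seen_right _ = False"

text \<open>
  The first sighting in \<open>J\<close> comes after a move of the robber, so the entry before it, if any, is
  the one made after the last move of the cops: dropping it with \<open>butlast\<close> gives the history on which
  their current position was chosen.
\<close>

definition join_strategy :: "'a strategy \<Rightarrow> 'b list \<Rightarrow> ('a + 'b) strategy" where
  "join_strategy \<sigma> D h =
    (let C = (\<lambda>h. map Inl (\<sigma> (map (map_option projl) h)) @ map Inr D) in
     case dropWhile (\<lambda>x. \<not> seen_right x) h of
       [] \<Rightarrow> C h
     | x # _ \<Rightarrow> the x # tl (C (butlast (takeWhile (\<lambda>x. \<not> seen_right x) h))))"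

lemma not_seen_right_map_Inl: "x \<in> set (map (map_option Inl) h) \<Longrightarrow> \<not> seen_right x"
  by (auto simp: map_option_case split: option.splits)

lemma map_projl_map_Inl: "map (map_option projl) (map (map_option Inl) h) = h"
  by (simp add: option.map_comp comp_def option.map_ident)

lemma join_strategy_left:
  fixes D :: "'b list"
  shows "join_strategy \<sigma> D (map (map_option Inl) h) = map Inl (\<sigma> h) @ map Inr D"
proof -
  have "dropWhile (\<lambda>x. \<not> seen_right x) (map (map_option Inl) h :: (_ + 'b) option list) = []"
    by (simp only: dropWhile_eq_Nil_conv) (use not_seen_right_map_Inl in blast)
  then show ?thesis
    by (simp only: join_strategy_def Let_def map_projl_map_Inl list.case(1))
qed

text \<open>The value does not depend on \<open>h'\<close>: after the first sighting in
  \<open>J\<close> the cops move once and then stand still.\<close>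

lemma join_strategy_right:
  "join_strategy \<sigma> D (map (map_option Inl) h @ Some (Inr v) # h') =
    Inr v # tl (map Inl (\<sigma> (butlast h)) @ map Inr D)"
proof -
  let ?h = "map (map_option Inl) h"
  have "dropWhile (\<lambda>x. \<not> seen_right x) (?h @ Some (Inr v) # h') = Some (Inr v) # h'"
    "takeWhile (\<lambda>x. \<not> seen_right x) (?h @ Some (Inr v) # h') = ?h"
    using not_seen_right_map_Inl by (subst dropWhile_append2 takeWhile_append2; force)+
  then show ?thesis
    by (simp only: join_strategy_def Let_def map_projl_map_Inl list.case(2) option.sel
        map_butlast[symmetric])
qed

text \<open>The cops choose their position of round \<open>t\<close> before the robber moves in that
  round. So the first claim needs nothing about \<open>\<rho> t\<close> and still holds when the
  robber has just entered \<open>J\<close>.\<close>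

lemma join_strategy_simulates:
  assumes "robber_play G \<tau>" and "set D \<subseteq> pverts J"
    and "\<And>s. s < t \<Longrightarrow> \<rho> s = Inl (\<tau> s)"
  shows "cops_at (graph_join G J) (join_strategy \<sigma> D) \<rho> t =
      map Inl (cops_at G \<sigma> \<tau> t) @ map Inr D"
    and "\<rho> t = Inl (\<tau> t) \<Longrightarrow> seen (graph_join G J) (join_strategy \<sigma> D) \<rho> t =
      map (map_option Inl) (seen G \<sigma> \<tau> t)"
proof -
  have V: "\<tau> s \<in> pverts G" for s
    using assms(1) by (cases s) (auto simp: robber_play_def adj_def)
  have nil: "join_strategy \<sigma> D [] = map Inl (\<sigma> []) @ map Inr D"
    using join_strategy_left[of \<sigma> D "[]"] by simp
  \<comment> \<open>Both claims share one induction: the next position comes from the history, and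
    the next history from that position.\<close>
  have "cops_at (graph_join G J) (join_strategy \<sigma> D) \<rho> t = map Inl (cops_at G \<sigma> \<tau> t) @ map Inr D \<and>
    (\<rho> t = Inl (\<tau> t) \<longrightarrow> seen (graph_join G J) (join_strategy \<sigma> D) \<rho> t =
      map (map_option Inl) (seen G \<sigma> \<tau> t))"
    using assms(3)
  proof (induction t)
    case 0
    then show ?case by (simp add: nil observation_graph_join_Inl V assms(2))
  next
    case (Suc t)
    then have "seen (graph_join G J) (join_strategy \<sigma> D) \<rho> t = map (map_option Inl) (seen G \<sigma> \<tau> t)"
      "\<rho> t = Inl (\<tau> t)" by auto
    then show ?case
      by (simp add: join_strategy_left observation_graph_join_Inl V assms(2))
  qed
  then show "cops_at (graph_join G J) (join_strategy \<sigma> D) \<rho> t =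
      map Inl (cops_at G \<sigma> \<tau> t) @ map Inr D"
    and "\<rho> t = Inl (\<tau> t) \<Longrightarrow> seen (graph_join G J) (join_strategy \<sigma> D) \<rho> t =
      map (map_option Inl) (seen G \<sigma> \<tau> t)"
    by auto
qed

text \<open>Because of \<open>d\<close>, the robber is visible on entering \<open>J\<close>; the
  first cop answers by going to \<open>v\<close>, and all others keep the position they had at time
  \<open>T\<close>.\<close>

lemma join_strategy_catches:
  assumes "robber_play G \<tau>" and "set D \<subseteq> pverts J"
    and "\<And>s. s < T \<Longrightarrow> \<rho> s = Inl (\<tau> s)" and "\<rho> T = Inr v"
    and "d \<in> set D" and "\<not> adj J d v"
  shows "cops_at (graph_join G J) (join_strategy \<sigma> D) \<rho> (Suc (T + m)) =
    Inr v # tl (map Inl (cops_at G \<sigma> \<tau> T) @ map Inr D)"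
proof -
  let ?seen = "seen (graph_join G J) (join_strategy \<sigma> D) \<rho>"
  have cops: "cops_at (graph_join G J) (join_strategy \<sigma> D) \<rho> T =
      map Inl (cops_at G \<sigma> \<tau> T) @ map Inr D"
    by (rule join_strategy_simulates(1)) (use assms in auto)
  have "\<exists>h. ?seen T = map (map_option Inl) h @ [Some (Inr v)] \<and>
      cops_at G \<sigma> \<tau> T = \<sigma> (butlast h)"
  proof (cases T)
    case 0
    \<comment> \<open>If the robber starts in \<open>J\<close>, nothing precedes the sighting, and
      \<open>butlast [] = []\<close> gives the initial placement.\<close>
    then show ?thesis
      using cops assms(4) observation_graph_join_Inr[OF assms(5,6)]
      by (intro exI[of _ "[]"]) simp
  next
    case (Suc t)
    have seen: "?seen t = map (map_option Inl) (seen G \<sigma> \<tau> t)"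
      by (rule join_strategy_simulates(2)) (use assms Suc in auto)
    have "\<tau> t \<in> pverts G"
      using assms(1) by (auto simp: robber_play_def adj_def)
    \<comment> \<open>In round \<open>T\<close> the cops move while the robber is still on
      \<open>\<tau> t\<close>; that observation is the last entry of the witness, the one removed by
      \<open>butlast\<close>.\<close>
    then show ?thesis
      using Suc assms(2,3,4) seen
      by (intro exI[of _ "seen G \<sigma> \<tau> t @ [observation G (\<sigma> (seen G \<sigma> \<tau> t)) (\<tau> t)]"])
        (simp add: join_strategy_left observation_graph_join_Inl
          observation_graph_join_Inr[OF assms(5,6)])
  qed
  then obtain h where h: "?seen T = map (map_option Inl) h @ [Some (Inr v)]"
    "cops_at G \<sigma> \<tau> T = \<sigma> (butlast h)" by blast
  obtain h' where "?seen (T + m) = map (map_option Inl) h @ Some (Inr v) # h'"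
    using seen_prefix[of _ _ _ T m] h(1) by (metis append.assoc append_Cons append_Nil)
  then show ?thesis
    using join_strategy_right[of \<sigma> D h v h'] by (simp add: h(2))
qed

section \<open>Legal positions, and plays restricted to \<open>G\<close>\<close>

lemma cops_at_in_verts:
  assumes "legal_cop_play G k \<sigma> \<rho>"
  shows "length (cops_at G \<sigma> \<rho> t) = k" and "set (cops_at G \<sigma> \<rho> t) \<subseteq> pverts G"
proof -
  have "length (cops_at G \<sigma> \<rho> t) = k \<and> set (cops_at G \<sigma> \<rho> t) \<subseteq> pverts G"
  proof (induction t)
    case 0
    then show ?case using assms by (simp add: legal_cop_play_def)
  next
    case (Suc t)
    have "list_all2 (adj G) (cops_at G \<sigma> \<rho> t) (cops_at G \<sigma> \<rho> (Suc t))"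
      using assms unfolding legal_cop_play_def by blast
    then show ?case
      using Suc by (auto simp: list_all2_conv_all_nth adj_def in_set_conv_nth simp del: cops_at.simps)
  qed
  then show "length (cops_at G \<sigma> \<rho> t) = k" "set (cops_at G \<sigma> \<rho> t) \<subseteq> pverts G" by auto
qed

lemma list_all2_adj_refl: "set C \<subseteq> pverts G \<Longrightarrow> list_all2 (adj G) C C"
  by (rule list.rel_refl_strong) (auto simp: adj_def)

lemma robber_play_left:
  assumes "robber_play (graph_join G J) \<rho>" and "\<And>s. isl (\<rho> s)"
  shows "robber_play G (projl \<circ> \<rho>)"
proof -
  have "\<rho> s = Inl (projl (\<rho> s))" for s using assms(2) by simp
  then have "\<rho> 0 = Inl (projl (\<rho> 0))"
    and "adj (graph_join G J) (Inl (projl (\<rho> s))) (Inl (projl (\<rho> (Suc s))))" for s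
    using assms(1) unfolding robber_play_def by metis+
  then show ?thesis
    using assms(1) by (auto simp: robber_play_def pverts_graph_join)
qed

text \<open>Waiting is always allowed. This turns the part of a play before the robber enters
  \<open>J\<close> into an infinite play within \<open>G\<close>.\<close>

lemma robber_play_stop:
  assumes "robber_play G \<rho>"
  shows "robber_play G (\<lambda>s. \<rho> (min s T))"
proof -
  have "adj G (\<rho> (min s T)) (\<rho> (min (Suc s) T))" for s
  proof (cases "s < T")
    case True
    then have "min s T = s" "min (Suc s) T = Suc s" by auto
    then show ?thesis using assms by (simp add: robber_play_def)
  next
    case False
    then have "min s T = T" "min (Suc s) T = T" by auto
    then show ?thesis using assms by (simp add: robber_play_def adj_def)
  qed
  then show ?thesis using assms by (simp add: robber_play_def)
qed

section \<open>Winning strategies carried over from \<open>G\<close> to the join\<close>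

text \<open>The two stationary cops are generalised to any list \<open>D\<close> without a common
  neighbour in \<open>J\<close>, loops counted.\<close>

lemma cops_win_graph_join:
  assumes win: "cops_win G k" and ne: "pverts G \<noteq> {}"
    and D: "set D \<subseteq> pverts J" and far: "\<And>v. v \<in> pverts J \<Longrightarrow> \<exists>d\<in>set D. \<not> adj J d v"
  shows "cops_win (graph_join G J) (k + length D)"
proof -
  let ?H = "graph_join G J"
  obtain \<sigma> where \<sigma>: "robber_play G \<rho> \<Longrightarrow> legal_cop_play G k \<sigma> \<rho> \<and> captured G \<sigma> \<rho>" for \<rho>
    using win unfolding cops_win_def by blast
  let ?\<sigma> = "join_strategy \<sigma> D"
  \<comment> \<open>Some cop in \<open>G\<close> has to exist in order to step onto a robber in
    \<open>J\<close>.\<close>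
  have k: "k \<noteq> 0" using win not_cops_win_0[OF ne] by metis
  have step: "list_all2 (adj ?H) (map Inl (cops_at G \<sigma> \<tau> t) @ map Inr D)
      (map Inl (cops_at G \<sigma> \<tau> (Suc t)) @ map Inr D)" if "robber_play G \<tau>" for \<tau> t
  proof (rule list_all2_appendI)
    have "list_all2 (adj G) (cops_at G \<sigma> \<tau> t) (cops_at G \<sigma> \<tau> (Suc t))"
      using \<sigma>[OF that] unfolding legal_cop_play_def by blast
    then show "list_all2 (adj ?H) (map Inl (cops_at G \<sigma> \<tau> t)) (map Inl (cops_at G \<sigma> \<tau> (Suc t)))"
      by (simp add: list_all2_map1 list_all2_map2 del: cops_at.simps)
    show "list_all2 (adj ?H) (map Inr D) (map Inr D)"
      using list_all2_adj_refl[OF D] by (simp add: list_all2_map1 list_all2_map2)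
  qed
  have "legal_cop_play ?H (k + length D) ?\<sigma> \<rho> \<and> captured ?H ?\<sigma> \<rho>" if play: "robber_play ?H \<rho>" for \<rho>
  proof (cases "\<forall>s. isl (\<rho> s)")
    case True
    define \<tau> where "\<tau> = projl \<circ> \<rho>"
    have \<tau>: "robber_play G \<tau>" unfolding \<tau>_def by (rule robber_play_left[OF play]) (use True in simp)
    have \<rho>: "\<rho> s = Inl (\<tau> s)" for s using True by (simp add: \<tau>_def)
    have at: "cops_at ?H ?\<sigma> \<rho> t = map Inl (cops_at G \<sigma> \<tau> t) @ map Inr D" for t
      by (rule join_strategy_simulates(1)[OF \<tau> D \<rho>])
    note legal = conjunct1[OF \<sigma>[OF \<tau>]]
    have "legal_cop_play ?H (k + length D) ?\<sigma> \<rho>"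
      unfolding legal_cop_play_def at
      using cops_at_in_verts[OF legal, of 0] D step[OF \<tau>] by (auto simp: pverts_graph_join)
    moreover have "captured ?H ?\<sigma> \<rho>"
      using conjunct2[OF \<sigma>[OF \<tau>]] unfolding captured_def at \<rho> by auto
    ultimately show ?thesis ..
  next
    case False
    define T where "T = (LEAST s. \<not> isl (\<rho> s))"
    have "\<not> isl (\<rho> T)" unfolding T_def by (rule LeastI_ex) (use False in blast)
    then obtain v where v: "\<rho> T = Inr v" by (cases "\<rho> T") auto
    have isl: "isl (\<rho> s)" if "s < T" for s using that not_less_Least unfolding T_def by blast
    have inH: "\<rho> s \<in> pverts ?H" for s using play by (cases s) (auto simp: robber_play_def adj_def)
    have vJ: "v \<in> pverts J" using inH[of T] v by (auto simp: pverts_graph_join)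
    obtain d where d: "d \<in> set D" "\<not> adj J d v" using far[OF vJ] by blast
    \<comment> \<open>\<open>\<sigma>\<close> is known to be legal only against complete plays on
      \<open>G\<close>. The moves before \<open>T\<close> are therefore completed by waiting: on the
      last vertex in \<open>G\<close>, or on an arbitrary \<open>g\<close> if the robber starts in
      \<open>J\<close>.\<close>
    have "\<exists>\<tau>. robber_play G \<tau> \<and> (\<forall>s<T. \<rho> s = Inl (\<tau> s))"
    proof (cases T)
      case 0
      obtain g where "g \<in> pverts G" using ne by blast
      then have "robber_play G (\<lambda>_. g)" by (simp add: robber_play_def adj_def)
      then show ?thesis using 0 by blast
    next
      case (Suc T')
      have "robber_play G (projl \<circ> (\<lambda>s. \<rho> (min s T')))"
        by (rule robber_play_left[OF robber_play_stop[OF play]]) (use isl Suc in simp)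
      moreover have "\<forall>s<T. \<rho> s = Inl ((projl \<circ> (\<lambda>s. \<rho> (min s T'))) s)"
        using isl Suc by (simp add: min_absorb1)
      ultimately show ?thesis by blast
    qed
    then obtain \<tau> where \<tau>: "robber_play G \<tau>" and \<rho>: "\<And>s. s < T \<Longrightarrow> \<rho> s = Inl (\<tau> s)" by blast
    note legal = conjunct1[OF \<sigma>[OF \<tau>]]
    have before: "cops_at ?H ?\<sigma> \<rho> t = map Inl (cops_at G \<sigma> \<tau> t) @ map Inr D" if "t \<le> T" for t
      by (rule join_strategy_simulates(1)[OF \<tau> D \<rho>]) (use that in simp)
    obtain c C where C: "cops_at G \<sigma> \<tau> T = c # C"
      using cops_at_in_verts(1)[OF legal, of T] k by (cases "cops_at G \<sigma> \<tau> T") auto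
    \<comment> \<open>From time \<open>T\<close> on only the first cop moves; \<open>E\<close> holds
      the others.\<close>
    define E where "E = map Inl C @ map Inr D"
    have at_T: "cops_at ?H ?\<sigma> \<rho> T = Inl c # E" using before[of T] by (simp add: C E_def)
    have after: "cops_at ?H ?\<sigma> \<rho> (Suc (T + m)) = Inr v # E" for m
      using join_strategy_catches[OF \<tau> D \<rho> v d, of \<sigma> m] by (simp add: C E_def)
    have cG: "c \<in> pverts G" "set C \<subseteq> pverts G" using cops_at_in_verts(2)[OF legal, of T] C by auto
    have E: "list_all2 (adj ?H) E E"
      by (rule list_all2_adj_refl) (use cG D in \<open>auto simp: E_def pverts_graph_join\<close>)
    have "list_all2 (adj ?H) (cops_at ?H ?\<sigma> \<rho> t) (cops_at ?H ?\<sigma> \<rho> (Suc t))" for t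
    proof (cases t T rule: linorder_cases)
      case less
      then show ?thesis using step[OF \<tau>, of t] before[of t] before[of "Suc t"]
        by (simp del: cops_at.simps)
    next
      case equal
      \<comment> \<open>The jump from \<open>c\<close> to \<open>v\<close> is legal because the join
        has all edges between \<open>G\<close> and \<open>J\<close>.\<close>
      then show ?thesis using at_T after[of 0] E cG(1) vJ by (simp del: cops_at.simps)
    next
      case greater
      then obtain m where "t = Suc (T + m)" using less_iff_Suc_add by auto
      then show ?thesis using after[of m] after[of "Suc m"] E vJ
        by (simp add: adj_def[of J] del: cops_at.simps)
    qed
    moreover have "length (cops_at ?H ?\<sigma> \<rho> 0) = k + length D \<and> set (cops_at ?H ?\<sigma> \<rho> 0) \<subseteq> pverts ?H"
      using before[of 0] cops_at_in_verts[OF legal, of 0] D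
      by (auto simp: pverts_graph_join simp del: cops_at.simps)
    ultimately have "legal_cop_play ?H (k + length D) ?\<sigma> \<rho>"
      unfolding legal_cop_play_def by blast
    \<comment> \<open>The cops move first in round \<open>Suc T\<close>, so the robber is still on
      \<open>v\<close>: the second disjunct of \<open>captured\<close>.\<close>
    moreover have "captured ?H ?\<sigma> \<rho>"
      unfolding captured_def using after[of 0] v by (intro exI[of _ T]) (simp del: cops_at.simps)
    ultimately show ?thesis ..
  qed
  then show ?thesis unfolding cops_win_def by blast
qed

theorem theorem4p6:
  fixes G :: "'a pair_pre_digraph" and J :: "'b pair_pre_digraph" and n :: nat
  assumes "pair_graph G" and "Digraph_Component.connected (with_proj G)"
    and "pair_graph J" and "\<not> Digraph_Component.connected (with_proj J)"
    and "card (pre_digraph.sccs (with_proj J)) = n" and "n \<ge> 2"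
  shows "hyperopic_cop_number (graph_join G J) \<le> hyperopic_cop_number G + 2"
proof -
  interpret G: pair_graph G by fact
  interpret J: pair_graph J by fact
  have "pverts G \<noteq> {}"
    using assms(2) by (auto simp: connected_def strongly_connected_def)
  have "pre_digraph.sccs (with_proj J) \<noteq> {}" using assms(5,6) by auto
  then have "pverts J \<noteq> {}" using verts_nonempty_if_sccs_nonempty[of "with_proj J"] by simp
  \<comment> \<open>The closed neighbourhoods of \<open>a\<close> and \<open>b\<close> in
    \<open>J\<close> are disjoint, so every vertex of \<open>J\<close> is missed by one of the
    two.\<close>
  then obtain a b where ab: "a \<in> pverts J" "b \<in> pverts J" "\<And>r. \<not> (adj J a r \<and> adj J b r)"
    using connectedI_common_neighbour[OF assms(3)] assms(4) by blast
  have "cops_win G (hyperopic_cop_number G)"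
    unfolding hyperopic_cop_number_def using G.cops_win_card_verts by (rule LeastI)
  then have "cops_win (graph_join G J) (hyperopic_cop_number G + length [a, b])"
    by (rule cops_win_graph_join[OF _ \<open>pverts G \<noteq> {}\<close>]) (use ab in auto)
  then show ?thesis
    unfolding hyperopic_cop_number_def[of "graph_join G J"] by (intro Least_le) simp
qed

end
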